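(* Let $X^0$ be a set of mutually nondominated points and let $x_0\in X^0$ be a point such that the set $\mathcal{L}(x_0)=\bigcup_{j=1}^m\{x\in\mathbb{R}^n\mid f_j(x)\le f_j(x_0)\}$ is compact. Let $\{X^k\}$ be the sequence of sets of nondominated points produced by the Front Descent algorithm (described in the context), implemented so that, at each iteration $k$, the first point to be processed in the for loop over $X^k$ belongs to $\operatorname{argmin}_{x\in X^k}\theta(x)$. Then: (i) if $\sigma_k=\sigma>0$ for all $k$, there exists $\bar k$ such that $\Theta(X^k)\ge-\sigma$ for all $k\ge\bar k$; (ii) if $\sigma_k\to0$, then $\lim_{k\to\infty}\Theta(X^k)=0$.
   Context: Setting. $F=(f_1,\ldots,f_m)^\top:\mathbb{R}^n\to\mathbb{R}^m$ is continuously differentiable. For $u,w\in\mathbb{R}^m$: $u\le w$ means $u_i\le w_i$ for all $i$; $u<w$ means $u_i<w_i$ for all $i$; $u\lneqq w$ means $u\le w$ and $u\ne w$. A point $y$ is dominated by $x$ if $F(x)\lneqq F(y)$. A set of points is mutually nondominated if none of its points is dominated by another one. $\mathbf{1}\in\mathbb{R}^m$ is the all-ones vector. For $x,d\in\mathbb{R}^n$ let $\mathcal{D}(x,d)=\max_{j=1,\ldots,m}\nabla f_j(x)^\top d$. For nonempty $I\subseteq\{1,\ldots,m\}$ let $\theta^I(x)=\min_{d\in\mathbb{R}^n}\max_{j\in I}\nabla f_j(x)^\top d+\frac12\|d\|^2$ and let $v^I(x)$ be the unique minimizer; $\theta$ and $v$ denote $\theta^I$ and $v^I$ for $I=\{1,\ldots,m\}$.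 A common descent direction at $x$ is a direction that is a descent direction at $x$ for every $f_j$. A point $\bar x$ is Pareto-stationary if $\min_d\max_j\nabla f_j(\bar x)^\top d=0$, equivalently $\theta(\bar x)=0$. For a set $X\subseteq\mathbb{R}^n$ of mutually nondominated points, $\Theta(X)=\inf_{x\in X}\theta(x)$. Front Descent algorithm. Input: a nonempty finite set $X^0$ of mutually nondominated points; $\alpha_0>0$, $\delta\in(0,1)$, $\gamma\in(0,1)$, $\Gamma_1>0$, $\Gamma_2>0$, a sequence $\{\sigma_k\}\subseteq\mathbb{R}_+$ (nonnegative reals). The algorithm is run without stopping, producing an infinite sequence $\{X^k\}$. At iteration $k=0,1,\ldots$: set $\hat X^k=X^k$; then, sequentially for all $x_c\in X^k$, if $x_c\in\hat X^k$ at that moment, process $x_c$ as follows. (1) Refinement. If $\theta(x_c)<-\sigma_k$: compute a common descent direction $v_D(x_c)$ (arbitrary); if both $\mathcal{D}(x_c,v_D(x_c))\le-\Gamma_1\|v(x_c)\|^2$ and $\|v_D(x_c)\|\le\Gamma_2\|v(x_c)\|$, set $d_c=v_D(x_c)$, otherwise set $d_c=v(x_c)$; set $\alpha_c^k=\max_{h\in\mathbb{N}}\{\alpha_0\delta^h\mid F(x_c+\alpha_0\delta^hd_c)\le F(x_c)+\mathbf{1}\gamma\alpha_0\delta^h\mathcal{D}(x_c,d_c)\}$. Otherwise (if $\theta(x_c)\ge-\sigma_k$) set $d_c=v(x_c)$, $\alpha_c^k=0$. In both cases set $z_c^k=x_c+\alpha_c^kd_c$ and update $\hat X^k\leftarrow\hat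 X^k\setminus\{y\in\hat X^k\mid F(z_c^k)\lneqq F(y)\}\cup\{z_c^k\}$. (2) Exploration. For every nonempty proper subset $I\subsetneq\{1,\ldots,m\}$ with $\theta^I(z_c^k)<0$: if $z_c^k\in\hat X^k$ at that moment, set $\alpha_c^I=\max_{h\in\mathbb{N}}\{\alpha_0\delta^h\mid\forall y\in\hat X^k\ \exists j:\ f_j(z_c^k+\alpha_0\delta^hv^I(z_c^k))<f_j(y)\}$, let $w=z_c^k+\alpha_c^Iv^I(z_c^k)$ and update $\hat X^k\leftarrow\hat X^k\setminus\{y\in\hat X^k\mid F(w)\lneqq F(y)\}\cup\{w\}$. After all points have been considered, set $X^{k+1}=\hat X^k$. *)

theory Defs
  imports "HOL-Analysis.Analysis"
begin


definition grad :: "('a::real_inner \<Rightarrow> real) \<Rightarrow> 'a \<Rightarrow> 'a" where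
  "grad f x = (THE g. GDERIV f x :> g)"

abbreviation comp_grad :: "(real^'n \<Rightarrow> real^'m) \<Rightarrow> 'm \<Rightarrow> real^'n \<Rightarrow> real^'n" where
  "comp_grad F j \<equiv> grad (\<lambda>x. F x $ j)"

definition continuously_differentiable :: "(real^'n \<Rightarrow> real^'m) \<Rightarrow> bool" where
  "continuously_differentiable F \<longleftrightarrow>
     F differentiable_on UNIV \<and> (\<forall>j. continuous_on UNIV (comp_grad F j))"

text \<open>On \<^typ>\<open>real^'m\<close> the library order \<open>\<le>\<close> is the componentwise one.\<close>

definition dominates :: "(real^'n \<Rightarrow> real^'m) \<Rightarrow> real^'n \<Rightarrow> real^'n \<Rightarrow> bool" where
  "dominates F x y \<longleftrightarrow> F x \<le> F y \<and> F x \<noteq> F y"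

definition mutually_nondominated :: "(real^'n \<Rightarrow> real^'m) \<Rightarrow> (real^'n) set \<Rightarrow> bool" where
  "mutually_nondominated F X \<longleftrightarrow> (\<forall>x\<in>X. \<forall>y\<in>X. \<not> dominates F x y)"

definition max_slope :: "(real^'n \<Rightarrow> real^'m) \<Rightarrow> 'm set \<Rightarrow> real^'n \<Rightarrow> real^'n \<Rightarrow> real" where
  "max_slope F I x d = Max ((\<lambda>j. comp_grad F j x \<bullet> d) ` I)"

text \<open>The minimum defining \<open>\<theta>\<^sup>I\<close> is attained, at a unique point, because the
  objective is strongly convex; it is written here as an infimum.\<close>

definition theta_on :: "(real^'n \<Rightarrow> real^'m) \<Rightarrow> 'm set \<Rightarrow> real^'n \<Rightarrow> real" where
  "theta_on F I x = (INF d. max_slope F I x d + 1/2 * (norm d)\<^sup>2)"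

definition v_on :: "(real^'n \<Rightarrow> real^'m) \<Rightarrow> 'm set \<Rightarrow> real^'n \<Rightarrow> real^'n" where
  "v_on F I x =
     (THE d. is_arg_min (\<lambda>d. max_slope F I x d + 1/2 * (norm d)\<^sup>2) (\<lambda>_. True) d)"

abbreviation "slope F \<equiv> max_slope F UNIV"
abbreviation "theta F \<equiv> theta_on F UNIV"
abbreviation "steepest_dir F \<equiv> v_on F UNIV"

definition Theta :: "(real^'n \<Rightarrow> real^'m) \<Rightarrow> (real^'n) set \<Rightarrow> real" where
  "Theta F X = (INF x\<in>X. theta F x)"

definition descent_direction :: "('a::real_vector \<Rightarrow> real) \<Rightarrow> 'a \<Rightarrow> 'a \<Rightarrow> bool" where
  "descent_direction f x d \<longleftrightarrow> (\<exists>s>0. \<forall>t. 0 < t \<and> t \<le> s \<longrightarrow> f (x + t *\<^sub>R d) < f x)"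

definition common_descent_direction :: "(real^'n \<Rightarrow> real^'m) \<Rightarrow> real^'n \<Rightarrow> real^'n \<Rightarrow> bool" where
  "common_descent_direction F x d \<longleftrightarrow> (\<forall>j. descent_direction (\<lambda>x. F x $ j) x d)"



definition front_update ::
  "(real^'n \<Rightarrow> real^'m) \<Rightarrow> real^'n \<Rightarrow> (real^'n) set \<Rightarrow> (real^'n) set" where
  "front_update F z Y = (Y - {y \<in> Y. dominates F z y}) \<union> {z}"

text \<open>In the two line searches, \<open>1 :: real^'m\<close> is the all-ones vector, and
  \<^const>\<open>Greatest\<close> is the maximum of a set of real step sizes.\<close>

definition armijo_step ::
  "(real^'n \<Rightarrow> real^'m) \<Rightarrow> real \<Rightarrow> real \<Rightarrow> real \<Rightarrow> real^'n \<Rightarrow> real^'n \<Rightarrow> real" where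
  "armijo_step F \<alpha>\<^sub>0 \<delta> \<gamma> x d =
     (GREATEST \<alpha>. \<exists>h::nat. \<alpha> = \<alpha>\<^sub>0 * \<delta> ^ h \<and>
        F (x + \<alpha> *\<^sub>R d) \<le> F x + (\<gamma> * \<alpha> * slope F x d) *\<^sub>R 1)"

definition explore_step ::
  "(real^'n \<Rightarrow> real^'m) \<Rightarrow> real \<Rightarrow> real \<Rightarrow> (real^'n) set \<Rightarrow> real^'n \<Rightarrow> 'm set \<Rightarrow> real" where
  "explore_step F \<alpha>\<^sub>0 \<delta> Y z I =
     (GREATEST \<alpha>. \<exists>h::nat. \<alpha> = \<alpha>\<^sub>0 * \<delta> ^ h \<and>
        (\<forall>y\<in>Y. \<exists>j. F (z + \<alpha> *\<^sub>R v_on F I z) $ j < F y $ j))"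

definition safeguarded_dir ::
  "(real^'n \<Rightarrow> real^'m) \<Rightarrow> real \<Rightarrow> real \<Rightarrow> real^'n \<Rightarrow> real^'n \<Rightarrow> real^'n" where
  "safeguarded_dir F \<Gamma>\<^sub>1 \<Gamma>\<^sub>2 x vD =
     (if slope F x vD \<le> - \<Gamma>\<^sub>1 * (norm (steepest_dir F x))\<^sup>2 \<and>
         norm vD \<le> \<Gamma>\<^sub>2 * norm (steepest_dir F x)
      then vD else steepest_dir F x)"

text \<open>When \<open>\<theta>(x) \<ge> -\<sigma>\<close> the step size is zero, so the refined point is \<open>x\<close> itself
  and \<open>vD\<close> is not used.\<close>

definition refined_point ::
  "(real^'n \<Rightarrow> real^'m) \<Rightarrow> real \<Rightarrow> real \<Rightarrow> real \<Rightarrow> real \<Rightarrow> real \<Rightarrow> real \<Rightarrow>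
   real^'n \<Rightarrow> real^'n \<Rightarrow> real^'n" where
  "refined_point F \<alpha>\<^sub>0 \<delta> \<gamma> \<Gamma>\<^sub>1 \<Gamma>\<^sub>2 \<sigma> x vD =
     (let refine = theta F x < - \<sigma>;
          d = (if refine then safeguarded_dir F \<Gamma>\<^sub>1 \<Gamma>\<^sub>2 x vD else steepest_dir F x);
          \<alpha> = (if refine then armijo_step F \<alpha>\<^sub>0 \<delta> \<gamma> x d else 0)
      in x + \<alpha> *\<^sub>R d)"

definition explore ::
  "(real^'n \<Rightarrow> real^'m) \<Rightarrow> real \<Rightarrow> real \<Rightarrow> real^'n \<Rightarrow> 'm set \<Rightarrow> (real^'n) set \<Rightarrow> (real^'n) set" where
  "explore F \<alpha>\<^sub>0 \<delta> z I Y =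
     (if z \<in> Y then front_update F (z + explore_step F \<alpha>\<^sub>0 \<delta> Y z I *\<^sub>R v_on F I z) Y else Y)"

text \<open>The algorithm is nondeterministic in the common descent direction \<open>vD\<close> and in the
  order \<open>Is\<close> in which the index subsets are visited, so processing one point is a relation
  between the working set \<open>Y\<close> before and \<open>Y'\<close> after.\<close>

definition process_point ::
  "(real^'n \<Rightarrow> real^'m) \<Rightarrow> real \<Rightarrow> real \<Rightarrow> real \<Rightarrow> real \<Rightarrow> real \<Rightarrow> real \<Rightarrow>
   real^'n \<Rightarrow> (real^'n) set \<Rightarrow> (real^'n) set \<Rightarrow> bool" where
  "process_point F \<alpha>\<^sub>0 \<delta> \<gamma> \<Gamma>\<^sub>1 \<Gamma>\<^sub>2 \<sigma> x Y Y' \<longleftrightarrow>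
     (if x \<in> Y
      then \<exists>vD Is. (theta F x < - \<sigma> \<longrightarrow> common_descent_direction F x vD) \<and>
             (let z = refined_point F \<alpha>\<^sub>0 \<delta> \<gamma> \<Gamma>\<^sub>1 \<Gamma>\<^sub>2 \<sigma> x vD
              in distinct Is \<and> set Is = {I. I \<noteq> {} \<and> I \<subset> UNIV \<and> theta_on F I z < 0} \<and>
                 Y' = fold (explore F \<alpha>\<^sub>0 \<delta> z) Is (front_update F z Y))
      else Y' = Y)"

primrec process_points ::
  "(real^'n \<Rightarrow> real^'m) \<Rightarrow> real \<Rightarrow> real \<Rightarrow> real \<Rightarrow> real \<Rightarrow> real \<Rightarrow> real \<Rightarrow>
   (real^'n) list \<Rightarrow> (real^'n) set \<Rightarrow> (real^'n) set \<Rightarrow> bool" where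
  "process_points F \<alpha>\<^sub>0 \<delta> \<gamma> \<Gamma>\<^sub>1 \<Gamma>\<^sub>2 \<sigma> [] Y Y' \<longleftrightarrow> Y' = Y"
| "process_points F \<alpha>\<^sub>0 \<delta> \<gamma> \<Gamma>\<^sub>1 \<Gamma>\<^sub>2 \<sigma> (x # xs) Y Y' \<longleftrightarrow>
     (\<exists>Z. process_point F \<alpha>\<^sub>0 \<delta> \<gamma> \<Gamma>\<^sub>1 \<Gamma>\<^sub>2 \<sigma> x Y Z \<and>
          process_points F \<alpha>\<^sub>0 \<delta> \<gamma> \<Gamma>\<^sub>1 \<Gamma>\<^sub>2 \<sigma> xs Z Y')"

text \<open>An infinite run produces the sets \<open>X k\<close>; the list \<open>xs k\<close> enumerates \<open>X k\<close> in the order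
  in which iteration \<open>k\<close> considers its points.\<close>

definition front_descent_run ::
  "(real^'n \<Rightarrow> real^'m) \<Rightarrow> real \<Rightarrow> real \<Rightarrow> real \<Rightarrow> real \<Rightarrow> real \<Rightarrow> (nat \<Rightarrow> real) \<Rightarrow>
   (nat \<Rightarrow> (real^'n) list) \<Rightarrow> (nat \<Rightarrow> (real^'n) set) \<Rightarrow> bool" where
  "front_descent_run F \<alpha>\<^sub>0 \<delta> \<gamma> \<Gamma>\<^sub>1 \<Gamma>\<^sub>2 \<sigma> xs X \<longleftrightarrow>
     (\<forall>k. distinct (xs k) \<and> set (xs k) = X k \<and>
          process_points F \<alpha>\<^sub>0 \<delta> \<gamma> \<Gamma>\<^sub>1 \<Gamma>\<^sub>2 (\<sigma> k) (xs k) (X k) (X (Suc k)))"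

end

theory Submission
  imports Defs
begin

text \<open>Every set \<open>X k\<close> is mutually nondominated and contains a point weakly dominating \<open>x\<^sub>0\<close>, so
  it lies in the compact set of the hypothesis. On a compact set, a point with
  \<open>\<theta> \<le> -\<epsilon>\<close> and \<open>\<theta> < -\<sigma>\<close> is refined by an Armijo step bounded away from zero, which lowers all
  components of \<open>F\<close> by at least a constant \<open>\<beta> > 0\<close>. The refined point stays weakly dominated by
  some point of each later set, and no point of a mutually nondominated set is worse than another
  in every component. Hence the first points \<open>x\<^sub>k\<close>, \<open>x\<^sub>l\<close> of two iterations \<open>k < l\<close>, the former
  with a large refinement, satisfy \<open>f\<^sub>j x\<^sub>l \<le> f\<^sub>j x\<^sub>k - \<beta>\<close> for some \<open>j\<close>. Infinitely many such
  refinements would give a \<open>\<beta>\<close>-separated sequence in the compact image under \<open>F\<close>.\<close>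

section \<open>Gradients and the steepest common descent direction\<close>

text \<open>Riesz representation: on a Euclidean space the linear functional \<open>f'\<close> is
  the inner product with \<open>adjoint f' 1\<close>.\<close>

lemma has_derivative_imp_GDERIV:
  fixes f :: "'a::euclidean_space \<Rightarrow> real"
  assumes "(f has_derivative f') (at x)"
  shows "GDERIV f x :> adjoint f' 1"
proof -
  have "linear f'"
    using assms has_derivative_linear by blast
  then have "f' = (\<lambda>h. h \<bullet> adjoint f' 1)"
    by (simp add: fun_eq_iff adjoint_works)
  with assms show ?thesis
    unfolding gderiv_def by simp
qed

text \<open>As \<open>grad\<close> is a definite description, it denotes the gradient only once
  existence and uniqueness are known; both come from the Frechet derivative of
  \<open>F\<close>.\<close>

lemma GDERIV_comp_grad:
  assumes "continuously_differentiable F"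
  shows "GDERIV (\<lambda>x. F x $ j) x :> comp_grad F j x"
proof -
  obtain F' where "(F has_derivative F') (at x)"
    using assms unfolding continuously_differentiable_def differentiable_on_def differentiable_def
    by auto
  then have "((\<lambda>x. F x $ j) has_derivative (\<lambda>h. F' h $ j)) (at x)"
    by (rule bounded_linear.has_derivative[OF bounded_linear_vec_nth])
  then have "GDERIV (\<lambda>x. F x $ j) x :> adjoint (\<lambda>h. F' h $ j) 1"
    by (rule has_derivative_imp_GDERIV)
  moreover have "g = g'" if "GDERIV (\<lambda>x. F x $ j) x :> g" "GDERIV (\<lambda>x. F x $ j) x :> g'" for g g'
  proof -
    have "(\<lambda>h. h \<bullet> g) = (\<lambda>h. h \<bullet> g')"
      using that unfolding gderiv_def by (rule has_derivative_unique)
    then show ?thesis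
      by (simp add: fun_eq_iff vector_eq_ldot)
  qed
  ultimately have "\<exists>!g. GDERIV (\<lambda>x. F x $ j) x :> g"
    by blast
  then show ?thesis
    unfolding grad_def by (rule theI')
qed

lemma continuous_on_differentiable:
  assumes "continuously_differentiable F"
  shows "continuous_on S F"
  using assms unfolding continuously_differentiable_def
  by (metis differentiable_imp_continuous_on continuous_on_subset subset_UNIV)

text \<open>Chain rule along a ray. It feeds the mean value theorem in the Armijo estimate and the
  sign argument at t = 0 in the exploration step.\<close>

lemma DERIV_along_line:
  assumes "continuously_differentiable F"
  shows "((\<lambda>s. F (x + s *\<^sub>R d) $ j) has_real_derivative comp_grad F j (x + t *\<^sub>R d) \<bullet> d) (at t)"
proof -
  have "((\<lambda>s. x + s *\<^sub>R d) has_derivative (\<lambda>s. s *\<^sub>R d)) (at t)"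
    by (auto intro!: derivative_eq_intros)
  moreover have "((\<lambda>y. F y $ j) has_derivative (\<lambda>h. h \<bullet> comp_grad F j (x + t *\<^sub>R d))) (at (x + t *\<^sub>R d))"
    using GDERIV_comp_grad[OF assms] unfolding gderiv_def .
  ultimately have "((\<lambda>s. F (x + s *\<^sub>R d) $ j) has_derivative
      (\<lambda>s. (s *\<^sub>R d) \<bullet> comp_grad F j (x + t *\<^sub>R d))) (at t)"
    by (rule has_derivative_compose)
  then show ?thesis
    unfolding has_field_derivative_def by (simp add: inner_commute mult_commute_abs)
qed

lemma comp_grad_le_max_slope:
  fixes F :: "real^'n \<Rightarrow> real^'m"
  shows "j \<in> I \<Longrightarrow> comp_grad F j x \<bullet> d \<le> max_slope F I x d"
  unfolding max_slope_def by (intro Max_ge) auto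

lemma max_slope_le_iff:
  fixes F :: "real^'n \<Rightarrow> real^'m"
  shows "I \<noteq> {} \<Longrightarrow> max_slope F I x d \<le> c \<longleftrightarrow> (\<forall>j\<in>I. comp_grad F j x \<bullet> d \<le> c)"
  unfolding max_slope_def by (subst Max_le_iff) auto

lemma max_slope_scaleR:
  fixes F :: "real^'n \<Rightarrow> real^'m"
  assumes "I \<noteq> {}" "t \<ge> 0"
  shows "max_slope F I x (t *\<^sub>R d) = t * max_slope F I x d"
proof -
  have "mono ((*) t)"
    using assms by (auto intro!: monoI mult_left_mono)
  then have "t * max_slope F I x d = Max ((*) t ` (\<lambda>j. comp_grad F j x \<bullet> d) ` I)"
    unfolding max_slope_def using assms by (intro mono_Max_commute) auto
  then show ?thesis
    by (simp add: max_slope_def image_image)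
qed

text \<open>With positive homogeneity this makes the slope sublinear, hence convex, in the
  direction.\<close>

lemma max_slope_add_le:
  fixes F :: "real^'n \<Rightarrow> real^'m"
  assumes "I \<noteq> {}"
  shows "max_slope F I x (d + e) \<le> max_slope F I x d + max_slope F I x e"
  using assms by (auto simp: max_slope_le_iff inner_add_right intro!: add_mono comp_grad_le_max_slope)

lemma continuous_on_Max_image:
  fixes f :: "'i \<Rightarrow> 'a::topological_space \<Rightarrow> 'b::linorder_topology"
  assumes "finite I" "I \<noteq> {}" "\<And>i. i \<in> I \<Longrightarrow> continuous_on S (f i)"
  shows "continuous_on S (\<lambda>x. Max ((\<lambda>i. f i x) ` I))"
  using assms
proof (induction I rule: finite_ne_induct)
  case (insert i I)
  then have "continuous_on S (\<lambda>x. max (f i x) (Max ((\<lambda>i. f i x) ` I)))"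
    by (intro continuous_on_max) auto
  with insert.hyps show ?case
    by simp
qed simp

section \<open>Minimizers of the direction subproblem\<close>

lemma direction_objective_attains_min:
  fixes F :: "real^'n \<Rightarrow> real^'m"
  assumes "I \<noteq> {}"
  shows "\<exists>d. is_arg_min (\<lambda>d. max_slope F I x d + 1/2 * (norm d)\<^sup>2) (\<lambda>_. True) d"
proof -
  define \<phi> where "\<phi> d = max_slope F I x d + 1/2 * (norm d)\<^sup>2" for d
  obtain j where j: "j \<in> I"
    using assms by auto
  \<comment> \<open>Coercivity: beyond radius 2 G the lower bound - G * norm d + (norm d)^2 / 2 is
    nonnegative, while the minimum over the ball is at most \<open>\<phi> 0 = 0\<close>. So the
    latter is global.\<close>
  define G where "G = norm (comp_grad F j x)"
  have "continuous_on (cball 0 (2 * G)) \<phi>"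
    unfolding \<phi>_def max_slope_def using assms
    by (intro continuous_intros continuous_on_Max_image) auto
  then obtain v where v: "v \<in> cball 0 (2 * G)" "\<And>d. d \<in> cball 0 (2 * G) \<Longrightarrow> \<phi> v \<le> \<phi> d"
    using continuous_attains_inf[of "cball 0 (2 * G)" \<phi>] by (auto simp: G_def)
  have "\<phi> 0 = 0"
    using assms by (simp add: \<phi>_def max_slope_def image_constant_conv)
  then have "\<phi> v \<le> 0"
    using v(2)[of 0] by (simp add: G_def)
  have "\<phi> v \<le> \<phi> d" for d
  proof (cases "norm d \<le> 2 * G")
    case False
    have "- (G * norm d) \<le> comp_grad F j x \<bullet> d"
      using Cauchy_Schwarz_ineq2[of "comp_grad F j x" d] by (simp add: G_def)
    also have "\<dots> \<le> max_slope F I x d"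
      by (rule comp_grad_le_max_slope[OF j])
    finally have "- (G * norm d) + 1/2 * (norm d)\<^sup>2 \<le> \<phi> d"
      by (simp add: \<phi>_def)
    moreover have "2 * G * norm d \<le> norm d * norm d"
      using False by (intro mult_right_mono) auto
    ultimately show ?thesis
      using \<open>\<phi> v \<le> 0\<close> by (simp add: power2_eq_square)
  qed (use v(2) in auto)
  then show ?thesis
    by (auto simp: is_arg_min_linorder \<phi>_def)
qed

text \<open>Strong convexity: at the midpoint of two minimizers the objective is below the minimum
  by at least (norm (d - e))^2 / 8.\<close>

lemma direction_objective_min_unique:
  fixes F :: "real^'n \<Rightarrow> real^'m"
  assumes "I \<noteq> {}"
    and d: "is_arg_min (\<lambda>d. max_slope F I x d + 1/2 * (norm d)\<^sup>2) (\<lambda>_. True) d"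
    and e: "is_arg_min (\<lambda>d. max_slope F I x d + 1/2 * (norm d)\<^sup>2) (\<lambda>_. True) e"
  shows "d = e"
proof -
  define m where "m = (1/2) *\<^sub>R (d + e)"
  have "max_slope F I x m \<le> 1/2 * (max_slope F I x d + max_slope F I x e)"
    using max_slope_add_le[OF assms(1), of F x d e]
    by (simp add: m_def max_slope_scaleR[OF assms(1)] del: scaleR_add_right)
  \<comment> \<open>Parallelogram law.\<close>
  moreover have "(norm m)\<^sup>2 = 1/2 * (norm d)\<^sup>2 + 1/2 * (norm e)\<^sup>2 - 1/4 * (norm (d - e))\<^sup>2"
    unfolding m_def power2_norm_eq_inner
    by (simp add: inner_diff inner_add inner_commute algebra_simps)
  ultimately have "max_slope F I x m + 1/2 * (norm m)\<^sup>2 \<le>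
      1/2 * (max_slope F I x d + 1/2 * (norm d)\<^sup>2) + 1/2 * (max_slope F I x e + 1/2 * (norm e)\<^sup>2)
      - 1/8 * (norm (d - e))\<^sup>2"
    by argo
  moreover have "max_slope F I x d + 1/2 * (norm d)\<^sup>2 \<le> max_slope F I x m + 1/2 * (norm m)\<^sup>2"
    "max_slope F I x e + 1/2 * (norm e)\<^sup>2 \<le> max_slope F I x m + 1/2 * (norm m)\<^sup>2"
    using d e by (auto simp: is_arg_min_linorder)
  ultimately have "(norm (d - e))\<^sup>2 \<le> 0"
    by argo
  then show ?thesis
    by simp
qed

lemma is_arg_min_v_on:
  fixes F :: "real^'n \<Rightarrow> real^'m"
  assumes "I \<noteq> {}"
  shows "is_arg_min (\<lambda>d. max_slope F I x d + 1/2 * (norm d)\<^sup>2) (\<lambda>_. True) (v_on F I x)"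
  unfolding v_on_def
  using direction_objective_attains_min[OF assms] direction_objective_min_unique[OF assms]
  by (rule theI'[OF ex_ex1I])

text \<open>Along the ray through the minimizer the objective is the quadratic \<open>q\<close>,
  which is minimal at t = 1; its derivative there vanishes.\<close>

lemma max_slope_v_on:
  fixes F :: "real^'n \<Rightarrow> real^'m"
  assumes "I \<noteq> {}"
  shows "max_slope F I x (v_on F I x) = - (norm (v_on F I x))\<^sup>2"
proof -
  define v where "v = v_on F I x"
  define q where "q t = t * max_slope F I x v + 1/2 * (t\<^sup>2 * (norm v)\<^sup>2)" for t :: real
  have q: "q t = max_slope F I x (t *\<^sub>R v) + 1/2 * (norm (t *\<^sub>R v))\<^sup>2" if "t \<ge> 0" for t
    using that assms by (simp add: q_def max_slope_scaleR power_mult_distrib)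
  \<comment> \<open>Radius 1 keeps t positive, where positive homogeneity identifies
    \<open>q\<close> with the objective.\<close>
  have "q 1 \<le> q t" if "\<bar>1 - t\<bar> < 1" for t
  proof -
    have "max_slope F I x (1 *\<^sub>R v) + 1/2 * (norm (1 *\<^sub>R v))\<^sup>2 \<le>
        max_slope F I x (t *\<^sub>R v) + 1/2 * (norm (t *\<^sub>R v))\<^sup>2"
      using is_arg_min_v_on[OF assms, of F x] unfolding is_arg_min_linorder v_def scaleR_one by blast
    then show ?thesis
      using that q[of t] q[of 1] by simp
  qed
  moreover have "(q has_real_derivative max_slope F I x v + (norm v)\<^sup>2) (at 1)"
    unfolding q_def by (auto intro!: derivative_eq_intros)
  ultimately have "max_slope F I x v + (norm v)\<^sup>2 = 0"
    by (intro DERIV_local_min[where f=q and d=1 and x=1]) auto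
  then show ?thesis
    by (simp add: v_def)
qed

lemma theta_on_eq:
  fixes F :: "real^'n \<Rightarrow> real^'m"
  assumes "I \<noteq> {}"
  shows "theta_on F I x = - (norm (v_on F I x))\<^sup>2 / 2"
proof -
  have "theta_on F I x = max_slope F I x (v_on F I x) + 1/2 * (norm (v_on F I x))\<^sup>2"
    unfolding theta_on_def using is_arg_min_v_on[OF assms, of F x]
    by (intro cInf_eq_minimum) (auto simp: is_arg_min_linorder)
  then show ?thesis
    by (simp add: max_slope_v_on[OF assms])
qed

text \<open>Cauchy-Schwarz applied to \<open>max_slope_v_on\<close>. By continuity of one component
  gradient, the steepest directions are thus bounded on compact sets.\<close>

lemma norm_v_on_le:
  fixes F :: "real^'n \<Rightarrow> real^'m"
  assumes "j \<in> I"
  shows "norm (v_on F I x) \<le> norm (comp_grad F j x)"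
proof -
  let ?v = "v_on F I x"
  have "I \<noteq> {}"
    using assms by auto
  have "- (norm (comp_grad F j x) * norm ?v) \<le> comp_grad F j x \<bullet> ?v"
    using Cauchy_Schwarz_ineq2[of "comp_grad F j x" ?v] by simp
  also have "\<dots> \<le> - (norm ?v)\<^sup>2"
    using comp_grad_le_max_slope[OF assms] max_slope_v_on[OF \<open>I \<noteq> {}\<close>] by metis
  finally have "norm ?v * norm ?v \<le> norm (comp_grad F j x) * norm ?v"
    by (simp add: power2_eq_square)
  then show ?thesis
    by (cases "norm ?v = 0") (auto dest: mult_right_le_imp_le)
qed

section \<open>Line searches\<close>

text \<open>Serves both line searches: the set of accepted steps has a maximum, so
  \<open>Greatest\<close> is meaningful, and that maximum has a lower bound depending only on \<eta>
  and the parameters.\<close>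

lemma backtracking_Greatest:
  fixes \<alpha>\<^sub>0 \<delta> :: real
  assumes "\<alpha>\<^sub>0 > 0" "0 < \<delta>" "\<delta> < 1" and "\<eta> > 0" and P: "\<And>t. 0 < t \<Longrightarrow> t \<le> \<eta> \<Longrightarrow> P t"
  defines "s \<equiv> (GREATEST \<alpha>. \<exists>h::nat. \<alpha> = \<alpha>\<^sub>0 * \<delta> ^ h \<and> P \<alpha>)"
  shows "P s" and "min \<alpha>\<^sub>0 (\<delta> * \<eta>) \<le> s"
proof -
  have "(\<lambda>h. \<alpha>\<^sub>0 * \<delta> ^ h) \<longlonglongrightarrow> \<alpha>\<^sub>0 * 0"
    using assms by (intro tendsto_intros LIMSEQ_realpow_zero) auto
  then have "\<forall>\<^sub>F h in sequentially. \<alpha>\<^sub>0 * \<delta> ^ h < \<eta>"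
    using \<open>\<eta> > 0\<close> by (auto dest: order_tendstoD)
  then obtain h\<^sub>0 where "\<alpha>\<^sub>0 * \<delta> ^ h\<^sub>0 < \<eta>"
    by (auto simp: eventually_sequentially)
  then have "P (\<alpha>\<^sub>0 * \<delta> ^ h\<^sub>0)"
    using assms by simp
  \<comment> \<open>Trial steps decrease in the exponent, so the greatest accepted step has the
    least accepted exponent.\<close>
  define h where "h = (LEAST h. P (\<alpha>\<^sub>0 * \<delta> ^ h))"
  have Ph: "P (\<alpha>\<^sub>0 * \<delta> ^ h)"
    unfolding h_def by (rule LeastI) fact
  have s: "s = \<alpha>\<^sub>0 * \<delta> ^ h"
    unfolding s_def
  proof (rule Greatest_equality)
    fix y assume "\<exists>k. y = \<alpha>\<^sub>0 * \<delta> ^ k \<and> P y"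
    then obtain k where k: "y = \<alpha>\<^sub>0 * \<delta> ^ k" "P (\<alpha>\<^sub>0 * \<delta> ^ k)"
      by blast
    then have "h \<le> k"
      unfolding h_def by (simp add: Least_le)
    then show "y \<le> \<alpha>\<^sub>0 * \<delta> ^ h"
      using assms k by (simp add: power_decreasing)
  qed (use Ph in blast)
  with Ph show "P s"
    by simp
  show "min \<alpha>\<^sub>0 (\<delta> * \<eta>) \<le> s"
  proof (cases h)
    case (Suc k)
    \<comment> \<open>The preceding trial step was rejected, so it exceeds \<eta>; the accepted step
      is \<delta> times it.\<close>
    then have "\<not> P (\<alpha>\<^sub>0 * \<delta> ^ k)"
      unfolding h_def by (metis lessI not_less_Least)
    then have "\<eta> < \<alpha>\<^sub>0 * \<delta> ^ k"
      using assms by (metis not_le_imp_less mult_pos_pos zero_less_power)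
    then have "\<delta> * \<eta> \<le> \<delta> * (\<alpha>\<^sub>0 * \<delta> ^ k)"
      using \<open>0 < \<delta>\<close> by (intro mult_left_mono) auto
    also have "\<dots> = s"
      by (simp add: s Suc)
    finally show ?thesis
      by simp
  qed (simp add: s)
qed

text \<open>By the mean value theorem the increment is t times a slope at an intermediate point.
  Uniform continuity of the gradients keeps that slope within (1 - \<gamma>) * c of the slope at x,
  which is the slack that the Armijo condition leaves.\<close>

lemma armijo_condition_uniform:
  fixes F :: "real^'n \<Rightarrow> real^'m"
  assumes C1: "continuously_differentiable F" and "compact K" "c > 0" "\<gamma> < 1" "M > 0"
  obtains \<eta> where "\<eta> > 0"
    "\<And>x d t. \<lbrakk>x \<in> K; norm d \<le> M; slope F x d \<le> - c; 0 < t; t \<le> \<eta>\<rbrakk> \<Longrightarrow>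
       F (x + t *\<^sub>R d) \<le> F x + (\<gamma> * t * slope F x d) *\<^sub>R 1"
proof -
  define K' where "K' = {x + y |x y. x \<in> K \<and> y \<in> cball 0 M}"
  have "compact K'"
    unfolding K'_def using \<open>compact K\<close> by (intro compact_sums) auto
  have "\<exists>\<eta>>0. \<forall>x\<in>K. \<forall>d t. norm d \<le> M \<longrightarrow> slope F x d \<le> - c \<longrightarrow> 0 < t \<longrightarrow> t \<le> \<eta> \<longrightarrow>
     F (x + t *\<^sub>R d) $ j \<le> F x $ j + \<gamma> * t * slope F x d" for j
  proof -
    have "uniformly_continuous_on K' (comp_grad F j)"
      using C1 \<open>compact K'\<close> unfolding continuously_differentiable_def
      by (intro compact_uniformly_continuous) (auto intro: continuous_on_subset)
    \<comment> \<open>Multiplied by \<open>norm d\<close>, which is at most M, this tolerance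
      becomes (1 - \<gamma>) * c.\<close>
    then obtain r where r: "r > 0" "\<And>x y. \<lbrakk>x \<in> K'; y \<in> K'; dist y x < r\<rbrakk> \<Longrightarrow>
        dist (comp_grad F j y) (comp_grad F j x) < (1 - \<gamma>) * c / M"
      using assms unfolding uniformly_continuous_on_def
      by (metis (no_types, lifting) diff_gt_0_iff_gt divide_pos_pos mult_pos_pos)
    \<comment> \<open>The bound 1 keeps the segment inside \<open>K'\<close>; the bound r / (2 * M)
      keeps the displacement strictly below r.\<close>
    define \<eta> where "\<eta> = min 1 (r / (2 * M))"
    have "F (x + t *\<^sub>R d) $ j \<le> F x $ j + \<gamma> * t * slope F x d"
      if H: "x \<in> K" "norm d \<le> M" "slope F x d \<le> - c" "0 < t" "t \<le> \<eta>" for x d t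
    proof -
      obtain s where s: "0 < s" "s < t"
        "F (x + t *\<^sub>R d) $ j - F (x + 0 *\<^sub>R d) $ j = (t - 0) * (comp_grad F j (x + s *\<^sub>R d) \<bullet> d)"
        using MVT2[OF \<open>0 < t\<close> DERIV_along_line[OF C1]] by blast
      have "s * norm d \<le> \<eta> * M"
        using s H by (intro mult_mono) auto
      moreover have "\<eta> * M \<le> 1 * M" "\<eta> * M \<le> r / (2 * M) * M"
        using \<open>M > 0\<close> unfolding \<eta>_def by (intro mult_right_mono; simp)+
      moreover have "r / (2 * M) * M < r"
        using \<open>M > 0\<close> \<open>r > 0\<close> by simp
      ultimately have "s * norm d \<le> M" "s * norm d < r"
        by linarith+
      moreover have "x \<in> K'"
        using H \<open>M > 0\<close> by (force simp: K'_def)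
      moreover have "x + s *\<^sub>R d \<in> K'"
        using H s \<open>s * norm d \<le> M\<close> by (force simp: K'_def)
      ultimately have "norm (comp_grad F j (x + s *\<^sub>R d) - comp_grad F j x) \<le> (1 - \<gamma>) * c / M"
        using r(2)[of x "x + s *\<^sub>R d"] s by (simp add: dist_norm)
      then have "norm (comp_grad F j (x + s *\<^sub>R d) - comp_grad F j x) * norm d \<le> (1 - \<gamma>) * c / M * M"
        using H assms by (intro mult_mono) auto
      then have "norm (comp_grad F j (x + s *\<^sub>R d) - comp_grad F j x) * norm d \<le> (1 - \<gamma>) * c"
        using \<open>M > 0\<close> by simp
      moreover have "(comp_grad F j (x + s *\<^sub>R d) - comp_grad F j x) \<bullet> d \<le>
          norm (comp_grad F j (x + s *\<^sub>R d) - comp_grad F j x) * norm d"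
        by (rule norm_cauchy_schwarz)
      moreover have "(1 - \<gamma>) * c \<le> (1 - \<gamma>) * - slope F x d"
        using H assms by (intro mult_left_mono) auto
      moreover have "comp_grad F j x \<bullet> d \<le> slope F x d"
        by (intro comp_grad_le_max_slope) auto
      ultimately have "comp_grad F j (x + s *\<^sub>R d) \<bullet> d \<le> \<gamma> * slope F x d"
        by (simp add: inner_diff_left algebra_simps)
      then have "t * (comp_grad F j (x + s *\<^sub>R d) \<bullet> d) \<le> t * (\<gamma> * slope F x d)"
        using H by (intro mult_left_mono) auto
      with s(3) show ?thesis
        by (simp add: algebra_simps)
    qed
    moreover have "\<eta> > 0"
      using r assms by (simp add: \<eta>_def)
    ultimately show ?thesis
      by blast
  qed
  then obtain \<eta> where \<eta>: "\<And>j. \<eta> j > 0"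
    "\<And>j x d t. \<lbrakk>x \<in> K; norm d \<le> M; slope F x d \<le> - c; 0 < t; t \<le> \<eta> j\<rbrakk> \<Longrightarrow>
     F (x + t *\<^sub>R d) $ j \<le> F x $ j + \<gamma> * t * slope F x d"
    by metis
  show thesis
  proof (rule that[of "Min (range \<eta>)"])
    show "Min (range \<eta>) > 0"
      using \<eta>(1) by (subst Min_gr_iff) auto
    fix x d t assume "x \<in> K" "norm d \<le> M" "slope F x d \<le> - c" "0 < t" "t \<le> Min (range \<eta>)"
    then show "F (x + t *\<^sub>R d) \<le> F x + (\<gamma> * t * slope F x d) *\<^sub>R 1"
      using \<eta>(2) by (auto simp: less_eq_vec_def)
  qed
qed

text \<open>Merges the two branches: an accepted \<open>vD\<close> obeys the tests, and the steepest
  direction satisfies both bounds with constant 1.\<close>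

lemma safeguarded_dir_bounds:
  fixes F :: "real^'n \<Rightarrow> real^'m"
  shows "slope F x (safeguarded_dir F \<Gamma>\<^sub>1 \<Gamma>\<^sub>2 x vD) \<le> - min 1 \<Gamma>\<^sub>1 * (norm (steepest_dir F x))\<^sup>2"
    and "norm (safeguarded_dir F \<Gamma>\<^sub>1 \<Gamma>\<^sub>2 x vD) \<le> max 1 \<Gamma>\<^sub>2 * norm (steepest_dir F x)"
proof -
  let ?v = "steepest_dir F x"
  have "min 1 \<Gamma>\<^sub>1 * (norm ?v)\<^sup>2 \<le> 1 * (norm ?v)\<^sup>2" "min 1 \<Gamma>\<^sub>1 * (norm ?v)\<^sup>2 \<le> \<Gamma>\<^sub>1 * (norm ?v)\<^sup>2"
    "1 * norm ?v \<le> max 1 \<Gamma>\<^sub>2 * norm ?v" "\<Gamma>\<^sub>2 * norm ?v \<le> max 1 \<Gamma>\<^sub>2 * norm ?v"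
    by (intro mult_right_mono; simp)+
  then show "slope F x (safeguarded_dir F \<Gamma>\<^sub>1 \<Gamma>\<^sub>2 x vD) \<le> - min 1 \<Gamma>\<^sub>1 * (norm ?v)\<^sup>2"
    and "norm (safeguarded_dir F \<Gamma>\<^sub>1 \<Gamma>\<^sub>2 x vD) \<le> max 1 \<Gamma>\<^sub>2 * norm ?v"
    using max_slope_v_on[of UNIV F x] by (auto simp: safeguarded_dir_def)
qed

text \<open>On K, theta at most - \<epsilon> bounds the slope away from zero, and compactness bounds
  the direction. Hence the Armijo step is at least \<open>a\<close> and the decrease at least
  \<gamma> * a * c.\<close>

lemma refined_point_uniform_decrease:
  fixes F :: "real^'n \<Rightarrow> real^'m"
  assumes C1: "continuously_differentiable F"
    and params: "\<alpha>\<^sub>0 > 0" "0 < \<delta>" "\<delta> < 1" "0 < \<gamma>" "\<gamma> < 1" "\<Gamma>\<^sub>1 > 0"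
    and "compact K" "\<epsilon> > 0"
  obtains \<beta> where "\<beta> > 0"
    "\<And>x \<sigma> vD j. \<lbrakk>x \<in> K; theta F x \<le> - \<epsilon>; theta F x < - \<sigma>\<rbrakk> \<Longrightarrow>
       F (refined_point F \<alpha>\<^sub>0 \<delta> \<gamma> \<Gamma>\<^sub>1 \<Gamma>\<^sub>2 \<sigma> x vD) $ j \<le> F x $ j - \<beta>"
proof -
  \<comment> \<open>The factor 2 * \<epsilon> comes from \<open>theta_on_eq\<close>: the squared
    norm of the steepest direction is - 2 * theta.\<close>
  define c where "c = min 1 \<Gamma>\<^sub>1 * (2 * \<epsilon>)"
  have "c > 0"
    using assms by (simp add: c_def)
  fix j\<^sub>0 :: 'm
  have "bounded (comp_grad F j\<^sub>0 ` K)"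
    using C1 \<open>compact K\<close> unfolding continuously_differentiable_def
    by (intro compact_imp_bounded compact_continuous_image) (auto intro: continuous_on_subset)
  then obtain B where B: "B > 0" "\<And>x. x \<in> K \<Longrightarrow> norm (comp_grad F j\<^sub>0 x) \<le> B"
    unfolding bounded_pos by auto
  define M where "M = max 1 \<Gamma>\<^sub>2 * B"
  have "M > 0"
    using B by (simp add: M_def)
  obtain \<eta> where \<eta>: "\<eta> > 0"
    "\<And>x d t. \<lbrakk>x \<in> K; norm d \<le> M; slope F x d \<le> - c; 0 < t; t \<le> \<eta>\<rbrakk> \<Longrightarrow>
       F (x + t *\<^sub>R d) \<le> F x + (\<gamma> * t * slope F x d) *\<^sub>R 1"
    using armijo_condition_uniform[OF C1 \<open>compact K\<close> \<open>c > 0\<close> \<open>\<gamma> < 1\<close> \<open>M > 0\<close>] by blast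
  define a where "a = min \<alpha>\<^sub>0 (\<delta> * \<eta>)"
  have "a > 0"
    using params \<eta>(1) by (simp add: a_def)
  show thesis
  proof (rule that[of "\<gamma> * a * c"])
    show "\<gamma> * a * c > 0"
      using \<open>a > 0\<close> \<open>c > 0\<close> params by simp
    fix x \<sigma> vD j assume x: "x \<in> K" "theta F x \<le> - \<epsilon>" "theta F x < - \<sigma>"
    define d where "d = safeguarded_dir F \<Gamma>\<^sub>1 \<Gamma>\<^sub>2 x vD"
    define s where "s = armijo_step F \<alpha>\<^sub>0 \<delta> \<gamma> x d"
    have z: "refined_point F \<alpha>\<^sub>0 \<delta> \<gamma> \<Gamma>\<^sub>1 \<Gamma>\<^sub>2 \<sigma> x vD = x + s *\<^sub>R d"
      using x by (simp add: refined_point_def Let_def d_def s_def)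
    have "2 * \<epsilon> \<le> (norm (steepest_dir F x))\<^sup>2"
      using x theta_on_eq[of UNIV F x] by simp
    then have "c \<le> min 1 \<Gamma>\<^sub>1 * (norm (steepest_dir F x))\<^sup>2"
      unfolding c_def using params by (intro mult_left_mono) auto
    then have slope: "slope F x d \<le> - c"
      using safeguarded_dir_bounds(1)[of F x \<Gamma>\<^sub>1 \<Gamma>\<^sub>2 vD] by (simp add: d_def)
    have "norm (steepest_dir F x) \<le> B"
      using norm_v_on_le[of j\<^sub>0 UNIV F x] B(2)[OF x(1)] by simp
    then have "max 1 \<Gamma>\<^sub>2 * norm (steepest_dir F x) \<le> M"
      unfolding M_def by (intro mult_left_mono) auto
    then have d: "norm d \<le> M"
      using safeguarded_dir_bounds(2)[of F \<Gamma>\<^sub>1 \<Gamma>\<^sub>2 x vD] by (simp add: d_def)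
    have "F (x + t *\<^sub>R d) \<le> F x + (\<gamma> * t * slope F x d) *\<^sub>R 1" if "0 < t" "t \<le> \<eta>" for t
      using \<eta>(2) x(1) d slope that by blast
    note step = backtracking_Greatest[OF params(1-3) \<eta>(1),
        of "\<lambda>t. F (x + t *\<^sub>R d) \<le> F x + (\<gamma> * t * slope F x d) *\<^sub>R 1",
        OF this, folded armijo_step_def, folded s_def a_def]
    have "F (x + s *\<^sub>R d) $ j \<le> (F x + (\<gamma> * s * slope F x d) *\<^sub>R 1) $ j"
      using step(1) unfolding less_eq_vec_def by blast
    then have "F (x + s *\<^sub>R d) $ j \<le> F x $ j + \<gamma> * s * slope F x d"
      by simp
    moreover have "\<gamma> * a * c \<le> \<gamma> * s * - slope F x d"
      using step(2) slope \<open>a > 0\<close> \<open>c > 0\<close> params by (intro mult_mono) auto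
    ultimately show "F (refined_point F \<alpha>\<^sub>0 \<delta> \<gamma> \<Gamma>\<^sub>1 \<Gamma>\<^sub>2 \<sigma> x vD) $ j \<le> F x $ j - \<gamma> * a * c"
      by (simp add: z)
  qed
qed

text \<open>If x is refined, the uniform decrease applies to the compact set {x} with \<epsilon> = -
  theta; otherwise the step is zero.\<close>

lemma refined_point_le:
  fixes F :: "real^'n \<Rightarrow> real^'m"
  assumes "continuously_differentiable F"
    and "\<alpha>\<^sub>0 > 0" "0 < \<delta>" "\<delta> < 1" "0 < \<gamma>" "\<gamma> < 1" "\<Gamma>\<^sub>1 > 0" "\<sigma> \<ge> 0"
  shows "F (refined_point F \<alpha>\<^sub>0 \<delta> \<gamma> \<Gamma>\<^sub>1 \<Gamma>\<^sub>2 \<sigma> x vD) \<le> F x"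
proof (cases "theta F x < - \<sigma>")
  case True
  then have "- theta F x > 0"
    using \<open>\<sigma> \<ge> 0\<close> by simp
  from refined_point_uniform_decrease[OF assms(1-7) compact_sing this, of x]
  obtain \<beta> where "\<beta> > 0" "\<And>y \<sigma> vD j. \<lbrakk>y \<in> {x}; theta F y \<le> - (- theta F x); theta F y < - \<sigma>\<rbrakk> \<Longrightarrow>
       F (refined_point F \<alpha>\<^sub>0 \<delta> \<gamma> \<Gamma>\<^sub>1 \<Gamma>\<^sub>2 \<sigma> y vD) $ j \<le> F y $ j - \<beta>"
    by blast
  from this(2)[of x \<sigma> vD] this(1) True show ?thesis
    unfolding less_eq_vec_def by (smt (verit) insertI1)
next
  case False
  then show ?thesis
    by (simp add: refined_point_def)
qed

text \<open>The exploration line search succeeds. A component in which z is already better than y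
  stays better by continuity; if there is none, y has the same image as z, and descent within I
  gives strict improvement. Finitely many y admit a common step bound.\<close>

lemma explore_step_nondominated:
  fixes F :: "real^'n \<Rightarrow> real^'m"
  assumes C1: "continuously_differentiable F" and params: "\<alpha>\<^sub>0 > 0" "0 < \<delta>" "\<delta> < 1"
    and Y: "finite Y" "mutually_nondominated F Y" "z \<in> Y"
    and I: "I \<noteq> {}" "theta_on F I z < 0" and "y \<in> Y"
  shows "\<exists>j. F (z + explore_step F \<alpha>\<^sub>0 \<delta> Y z I *\<^sub>R v_on F I z) $ j < F y $ j"
proof -
  let ?v = "v_on F I z"
  have "\<forall>\<^sub>F t in at_right 0. \<exists>j. F (z + t *\<^sub>R ?v) $ j < F y $ j" if "y \<in> Y" for y
  proof (cases "\<exists>j. F z $ j < F y $ j")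
    case True
    then obtain j where j: "F z $ j < F y $ j" ..
    have "((\<lambda>t. F (z + t *\<^sub>R ?v) $ j) \<longlongrightarrow> F (z + 0 *\<^sub>R ?v) $ j) (at_right 0)"
      using DERIV_isCont[OF DERIV_along_line[OF C1]]
      by (metis isCont_def filterlim_at_split)
    then have "\<forall>\<^sub>F t in at_right 0. F (z + t *\<^sub>R ?v) $ j < F y $ j"
      using j by (intro order_tendstoD) auto
    then show ?thesis
      by (rule eventually_mono) blast
  next
    case False
    then have "F y \<le> F z"
      by (simp add: less_eq_vec_def not_less)
    \<comment> \<open>Since z also lies in Y, y cannot dominate it.\<close>
    then have "F y = F z"
      using Y that unfolding mutually_nondominated_def dominates_def by blast
    obtain j where "j \<in> I"
      using I by auto
    \<comment> \<open>For j in I this slope is at most - (norm ?v)^2 = 2 * theta, which is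
      negative.\<close>
    then have "comp_grad F j z \<bullet> ?v < 0"
      using comp_grad_le_max_slope[of j I F z ?v] max_slope_v_on[OF I(1), of F z]
        theta_on_eq[OF I(1), of F z] I(2) by linarith
    then obtain r where "r > 0" "\<And>h. 0 < h \<Longrightarrow> h < r \<Longrightarrow> F (z + (0 + h) *\<^sub>R ?v) $ j < F (z + 0 *\<^sub>R ?v) $ j"
      using DERIV_neg_dec_right[OF DERIV_along_line[OF C1, of z ?v j 0]] by auto
    then show ?thesis
      unfolding eventually_at_right_field \<open>F y = F z\<close> by (intro exI[of _ r]) auto
  qed
  then have "\<forall>\<^sub>F t in at_right 0. \<forall>y\<in>Y. \<exists>j. F (z + t *\<^sub>R ?v) $ j < F y $ j"
    using Y(1) by (intro eventually_ball_finite) auto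
  then obtain b where "b > 0" and b: "\<And>t. 0 < t \<Longrightarrow> t < b \<Longrightarrow> \<forall>y\<in>Y. \<exists>j. F (z + t *\<^sub>R ?v) $ j < F y $ j"
    unfolding eventually_at_right_field by blast
  have "\<forall>y\<in>Y. \<exists>j. F (z + explore_step F \<alpha>\<^sub>0 \<delta> Y z I *\<^sub>R ?v) $ j < F y $ j"
    unfolding explore_step_def
  proof (rule backtracking_Greatest(1)[OF params, of "b / 2"
        "\<lambda>t. \<forall>y\<in>Y. \<exists>j. F (z + t *\<^sub>R ?v) $ j < F y $ j"])
    show "\<forall>y\<in>Y. \<exists>j. F (z + t *\<^sub>R ?v) $ j < F y $ j" if "0 < t" "t \<le> b / 2" for t
      using that \<open>b > 0\<close> by (intro b) simp_all
  qed (use \<open>b > 0\<close> in simp)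
  then show ?thesis
    using \<open>y \<in> Y\<close> by blast
qed

section \<open>Invariants of the algorithm\<close>

text \<open>A preorder on sets that replaces the tracking of single points: a point may be removed,
  but some point at least as good remains.\<close>

definition weakly_covers :: "(real^'n \<Rightarrow> real^'m) \<Rightarrow> (real^'n) set \<Rightarrow> (real^'n) set \<Rightarrow> bool" where
  "weakly_covers F Y' Y \<longleftrightarrow> (\<forall>y\<in>Y. \<exists>y'\<in>Y'. F y' \<le> F y)"

lemma weakly_covers_refl: "weakly_covers F Y Y"
  unfolding weakly_covers_def by blast

lemma weakly_covers_trans:
  "weakly_covers F Y'' Y' \<Longrightarrow> weakly_covers F Y' Y \<Longrightarrow> weakly_covers F Y'' Y"
  unfolding weakly_covers_def by (meson order_trans)

lemma weakly_covers_front_update: "weakly_covers F (front_update F z Y) Y"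
  unfolding weakly_covers_def front_update_def dominates_def by auto

lemma mutually_nondominated_front_update:
  assumes "mutually_nondominated F Y" "\<And>y. y \<in> Y \<Longrightarrow> \<not> dominates F y z"
  shows "mutually_nondominated F (front_update F z Y)"
  using assms unfolding mutually_nondominated_def front_update_def
  by (auto simp: dominates_def)

definition front :: "(real^'n \<Rightarrow> real^'m) \<Rightarrow> (real^'n) set \<Rightarrow> bool" where
  "front F Y \<longleftrightarrow> finite Y \<and> mutually_nondominated F Y"

lemma front_front_update:
  assumes "front F Y" "\<And>y. y \<in> Y \<Longrightarrow> \<not> dominates F y z"
  shows "front F (front_update F z Y)"
  using assms mutually_nondominated_front_update unfolding front_def
  by (auto simp: front_update_def)

text \<open>The line search gives the new point a strictly better component against every y, so no y
  dominates it. If z has left Y, nothing changes.\<close>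

lemma front_explore:
  fixes F :: "real^'n \<Rightarrow> real^'m"
  assumes C1: "continuously_differentiable F" and params: "\<alpha>\<^sub>0 > 0" "0 < \<delta>" "\<delta> < 1"
    and Y: "front F Y" and I: "I \<noteq> {}" "theta_on F I z < 0"
  shows "front F (explore F \<alpha>\<^sub>0 \<delta> z I Y)" "weakly_covers F (explore F \<alpha>\<^sub>0 \<delta> z I Y) Y"
proof -
  show "weakly_covers F (explore F \<alpha>\<^sub>0 \<delta> z I Y) Y"
    by (simp add: explore_def weakly_covers_front_update weakly_covers_refl)
  show "front F (explore F \<alpha>\<^sub>0 \<delta> z I Y)"
  proof (cases "z \<in> Y")
    case True
    have "\<not> dominates F y (z + explore_step F \<alpha>\<^sub>0 \<delta> Y z I *\<^sub>R v_on F I z)" if "y \<in> Y" for y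
    proof -
      obtain j where "F (z + explore_step F \<alpha>\<^sub>0 \<delta> Y z I *\<^sub>R v_on F I z) $ j < F y $ j"
        using explore_step_nondominated[OF C1 params _ _ True I \<open>y \<in> Y\<close>] Y by (auto simp: front_def)
      then show ?thesis
        by (auto simp: dominates_def less_eq_vec_def not_le)
    qed
    with True Y show ?thesis
      by (simp add: explore_def front_front_update)
  qed (use Y in \<open>simp add: explore_def\<close>)
qed

lemma front_fold_explore:
  fixes F :: "real^'n \<Rightarrow> real^'m"
  assumes "continuously_differentiable F" "\<alpha>\<^sub>0 > 0" "0 < \<delta>" "\<delta> < 1"
    and "front F Y" "\<And>I. I \<in> set Is \<Longrightarrow> I \<noteq> {} \<and> theta_on F I z < 0"
  shows "front F (fold (explore F \<alpha>\<^sub>0 \<delta> z) Is Y) \<and> weakly_covers F (fold (explore F \<alpha>\<^sub>0 \<delta> z) Is Y) Y"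
  using assms(5,6)
proof (induction Is arbitrary: Y)
  case (Cons I Is)
  then have "front F (explore F \<alpha>\<^sub>0 \<delta> z I Y)" "weakly_covers F (explore F \<alpha>\<^sub>0 \<delta> z I Y) Y"
    using front_explore[OF assms(1-4)] by auto
  with Cons show ?case
    by (auto intro: weakly_covers_trans)
qed (simp add: weakly_covers_refl)

text \<open>The third claim speaks of covering, not membership, because exploration may remove the
  refined point again.\<close>

lemma front_process_point:
  fixes F :: "real^'n \<Rightarrow> real^'m"
  assumes C1: "continuously_differentiable F"
    and params: "\<alpha>\<^sub>0 > 0" "0 < \<delta>" "\<delta> < 1" "0 < \<gamma>" "\<gamma> < 1" "\<Gamma>\<^sub>1 > 0" "\<sigma> \<ge> 0"
    and Y: "front F Y" and process: "process_point F \<alpha>\<^sub>0 \<delta> \<gamma> \<Gamma>\<^sub>1 \<Gamma>\<^sub>2 \<sigma> x Y Y'"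
  shows "front F Y'" "weakly_covers F Y' Y"
    "x \<in> Y \<Longrightarrow> \<exists>vD. weakly_covers F Y' {refined_point F \<alpha>\<^sub>0 \<delta> \<gamma> \<Gamma>\<^sub>1 \<Gamma>\<^sub>2 \<sigma> x vD}"
proof -
  have "front F Y' \<and> weakly_covers F Y' Y \<and>
    (x \<in> Y \<longrightarrow> (\<exists>vD. weakly_covers F Y' {refined_point F \<alpha>\<^sub>0 \<delta> \<gamma> \<Gamma>\<^sub>1 \<Gamma>\<^sub>2 \<sigma> x vD}))"
  proof (cases "x \<in> Y")
    case True
    then obtain vD Is where Is: "set Is = {I. I \<noteq> {} \<and> I \<subset> UNIV \<and>
        theta_on F I (refined_point F \<alpha>\<^sub>0 \<delta> \<gamma> \<Gamma>\<^sub>1 \<Gamma>\<^sub>2 \<sigma> x vD) < 0}"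
      and Y': "Y' = fold (explore F \<alpha>\<^sub>0 \<delta> (refined_point F \<alpha>\<^sub>0 \<delta> \<gamma> \<Gamma>\<^sub>1 \<Gamma>\<^sub>2 \<sigma> x vD)) Is
        (front_update F (refined_point F \<alpha>\<^sub>0 \<delta> \<gamma> \<Gamma>\<^sub>1 \<Gamma>\<^sub>2 \<sigma> x vD) Y)"
      using process unfolding process_point_def Let_def by auto
    define z where "z = refined_point F \<alpha>\<^sub>0 \<delta> \<gamma> \<Gamma>\<^sub>1 \<Gamma>\<^sub>2 \<sigma> x vD"
    have "F z \<le> F x"
      unfolding z_def by (rule refined_point_le[OF C1 params])
    \<comment> \<open>A point dominating z would dominate x too, although both belong to the
      nondominated set Y.\<close>
    have "\<not> dominates F y z" if "y \<in> Y" for y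
    proof
      assume "dominates F y z"
      with \<open>F z \<le> F x\<close> have "dominates F y x"
        by (auto simp: dominates_def)
      with Y True that show False
        by (simp add: front_def mutually_nondominated_def)
    qed
    then have "front F (front_update F z Y)"
      using Y by (intro front_front_update)
    then have "front F Y'" "weakly_covers F Y' (front_update F z Y)"
      using front_fold_explore[OF C1 params(1-3), of "front_update F z Y" Is z] Is
      by (auto simp: Y' z_def)
    moreover have "weakly_covers F (front_update F z Y) {z}"
      by (auto simp: weakly_covers_def front_update_def)
    ultimately have "weakly_covers F Y' Y" "weakly_covers F Y' {z}"
      by (auto intro: weakly_covers_trans weakly_covers_front_update)
    with \<open>front F Y'\<close> show ?thesis
      unfolding z_def by blast
  qed (use process Y in \<open>simp add: process_point_def weakly_covers_refl\<close>)
  then show "front F Y'" "weakly_covers F Y' Y"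
    "x \<in> Y \<Longrightarrow> \<exists>vD. weakly_covers F Y' {refined_point F \<alpha>\<^sub>0 \<delta> \<gamma> \<Gamma>\<^sub>1 \<Gamma>\<^sub>2 \<sigma> x vD}"
    by simp_all
qed

lemma front_process_points:
  fixes F :: "real^'n \<Rightarrow> real^'m"
  assumes "continuously_differentiable F"
    and "\<alpha>\<^sub>0 > 0" "0 < \<delta>" "\<delta> < 1" "0 < \<gamma>" "\<gamma> < 1" "\<Gamma>\<^sub>1 > 0" "\<sigma> \<ge> 0"
    and "front F Y" "process_points F \<alpha>\<^sub>0 \<delta> \<gamma> \<Gamma>\<^sub>1 \<Gamma>\<^sub>2 \<sigma> xs Y Y'"
  shows "front F Y' \<and> weakly_covers F Y' Y"
  using assms(9,10)
proof (induction xs arbitrary: Y)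
  case (Cons x xs)
  then obtain Z where Z: "process_point F \<alpha>\<^sub>0 \<delta> \<gamma> \<Gamma>\<^sub>1 \<Gamma>\<^sub>2 \<sigma> x Y Z"
    "process_points F \<alpha>\<^sub>0 \<delta> \<gamma> \<Gamma>\<^sub>1 \<Gamma>\<^sub>2 \<sigma> xs Z Y'"
    by auto
  note process = front_process_point(1,2)[OF assms(1-8) Cons.prems(1) Z(1)]
  have "front F Y'" "weakly_covers F Y' Z"
    using Cons.IH[OF process(1) Z(2)] by auto
  with process(2) show ?case
    by (simp add: weakly_covers_trans[of F Y' Z Y])
qed (simp add: weakly_covers_refl)

lemma front_run:
  fixes F :: "real^'n \<Rightarrow> real^'m"
  assumes "continuously_differentiable F"
    and "\<alpha>\<^sub>0 > 0" "0 < \<delta>" "\<delta> < 1" "0 < \<gamma>" "\<gamma> < 1" "\<Gamma>\<^sub>1 > 0" "\<And>k. \<sigma> k \<ge> 0"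
    and "front F (X 0)" and run: "front_descent_run F \<alpha>\<^sub>0 \<delta> \<gamma> \<Gamma>\<^sub>1 \<Gamma>\<^sub>2 \<sigma> xs X"
  shows "front F (X k)" and "k \<le> l \<Longrightarrow> weakly_covers F (X l) (X k)"
proof -
  have iteration: "process_points F \<alpha>\<^sub>0 \<delta> \<gamma> \<Gamma>\<^sub>1 \<Gamma>\<^sub>2 (\<sigma> k) (xs k) (X k) (X (Suc k))" for k
    using run unfolding front_descent_run_def by blast
  have front: "front F (X k)" for k
  proof (induction k)
    case (Suc k)
    then show ?case
      using front_process_points[OF assms(1-8) _ iteration] by simp
  qed (rule assms(9))
  then show "front F (X k)" .
  show "weakly_covers F (X l) (X k)" if "k \<le> l"
    using that
  proof (induction l rule: dec_induct)
    case (step n)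
    have "weakly_covers F (X (Suc n)) (X n)"
      using front_process_points[OF assms(1-8) front iteration] by simp
    then show ?case
      using step.IH by (rule weakly_covers_trans)
  qed (simp add: weakly_covers_refl)
qed

section \<open>Separation in the objective space\<close>

text \<open>Otherwise the point covering u would beat x in every component and so dominate it. Used
  with \<open>x\<^sub>0\<close> as u to confine the iterates, and with a refined point as u to
  separate them.\<close>

lemma mutually_nondominated_le_component:
  fixes F :: "real^'n \<Rightarrow> real^'m"
  assumes "mutually_nondominated F Y" "weakly_covers F Y {u}" "x \<in> Y"
  shows "\<exists>j. F x $ j \<le> F u $ j"
proof (rule ccontr)
  assume "\<nexists>j. F x $ j \<le> F u $ j"
  then have *: "F u $ j < F x $ j" for j
    by (simp add: not_le)
  obtain y where y: "y \<in> Y" "F y \<le> F u"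
    using assms(2) unfolding weakly_covers_def by auto
  then have "F y $ j < F x $ j" for j
    using * by (meson le_less_trans less_eq_vec_def)
  then have "dominates F y x"
    unfolding dominates_def less_eq_vec_def by (metis less_imp_le less_irrefl)
  then show False
    using assms y unfolding mutually_nondominated_def by blast
qed

text \<open>A convergent subsequence is Cauchy, so two of its consecutive terms are close.\<close>

lemma compact_no_separated_sequence:
  fixes u :: "nat \<Rightarrow> 'a::metric_space"
  assumes "compact S" "\<And>n. u n \<in> S" "\<beta> > 0"
  shows "\<exists>m n. m < n \<and> dist (u n) (u m) < \<beta>"
proof -
  obtain l r where r: "strict_mono r" "(u \<circ> r) \<longlonglongrightarrow> l"
    using assms unfolding compact_def by (metis (full_types))
  then have "Cauchy (u \<circ> r)"
    by (intro LIMSEQ_imp_Cauchy)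
  then obtain N where "\<And>m n. m \<ge> N \<Longrightarrow> n \<ge> N \<Longrightarrow> dist ((u \<circ> r) m) ((u \<circ> r) n) < \<beta>"
    using \<open>\<beta> > 0\<close> unfolding Cauchy_def by blast
  then have "dist (u (r (Suc N))) (u (r N)) < \<beta>"
    by simp
  moreover have "r N < r (Suc N)"
    using r(1) by (simp add: strict_mono_Suc_iff)
  ultimately show ?thesis
    by blast
qed

text \<open>The two conditions on k imply theta < - \<sigma> at the first point, so it really is
  refined and the uniform decrease applies. This form serves both a constant and a vanishing
  \<sigma>.\<close>

lemma finite_large_refinements:
  fixes F :: "real^'n \<Rightarrow> real^'m"
  assumes C1: "continuously_differentiable F"
    and params: "\<alpha>\<^sub>0 > 0" "0 < \<delta>" "\<delta> < 1" "0 < \<gamma>" "\<gamma> < 1" "\<Gamma>\<^sub>1 > 0" "\<And>k. \<sigma> k \<ge> 0"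
    and init: "front F (X 0)" and x0: "x\<^sub>0 \<in> X 0" "compact (\<Union>j. {x. F x $ j \<le> F x\<^sub>0 $ j})"
    and run: "front_descent_run F \<alpha>\<^sub>0 \<delta> \<gamma> \<Gamma>\<^sub>1 \<Gamma>\<^sub>2 \<sigma> xs X"
    and hd: "\<And>k. hd (xs k) \<in> X k" and "\<epsilon> > 0"
  shows "finite {k. theta F (hd (xs k)) < - \<epsilon> \<and> \<sigma> k \<le> \<epsilon>}"
proof (rule ccontr)
  define N where "N = {k. theta F (hd (xs k)) < - \<epsilon> \<and> \<sigma> k \<le> \<epsilon>}"
  define L where "L = (\<Union>j. {x. F x $ j \<le> F x\<^sub>0 $ j})"
  note front = front_run(1)[OF C1 params init run]
  note covers = front_run(2)[OF C1 params init run]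
  have X_subset: "X k \<subseteq> L" for k
  proof
    fix x assume "x \<in> X k"
    moreover have "weakly_covers F (X k) {x\<^sub>0}"
      using covers[of 0 k] x0(1) unfolding weakly_covers_def by auto
    ultimately show "x \<in> L"
      using mutually_nondominated_le_component front unfolding front_def L_def by fast
  qed
  have "compact L"
    using x0(2) by (simp add: L_def)
  obtain \<beta> where \<beta>: "\<beta> > 0" "\<And>x \<sigma> vD j. \<lbrakk>x \<in> L; theta F x \<le> - \<epsilon>; theta F x < - \<sigma>\<rbrakk> \<Longrightarrow>
       F (refined_point F \<alpha>\<^sub>0 \<delta> \<gamma> \<Gamma>\<^sub>1 \<Gamma>\<^sub>2 \<sigma> x vD) $ j \<le> F x $ j - \<beta>"
    using refined_point_uniform_decrease[OF C1 params(1-6) \<open>compact L\<close> \<open>\<epsilon> > 0\<close>, where \<Gamma>\<^sub>2=\<Gamma>\<^sub>2] by blast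
  \<comment> \<open>The decrease takes place in iteration k; l is any later iteration.\<close>
  have separated: "dist (F (hd (xs l))) (F (hd (xs k))) \<ge> \<beta>" if "k \<in> N" "k < l" for k l
  proof -
    let ?x = "hd (xs k)"
    have "xs k \<noteq> []"
      using run hd[of k] unfolding front_descent_run_def by (metis empty_iff list.set(1))
    moreover have "process_points F \<alpha>\<^sub>0 \<delta> \<gamma> \<Gamma>\<^sub>1 \<Gamma>\<^sub>2 (\<sigma> k) (xs k) (X k) (X (Suc k))"
      using run unfolding front_descent_run_def by blast
    \<comment> \<open>The head of the list meets the working set while it still equals
      \<open>X k\<close>, so its membership test succeeds.\<close>
    ultimately obtain Z where Z: "process_point F \<alpha>\<^sub>0 \<delta> \<gamma> \<Gamma>\<^sub>1 \<Gamma>\<^sub>2 (\<sigma> k) ?x (X k) Z"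
      "process_points F \<alpha>\<^sub>0 \<delta> \<gamma> \<Gamma>\<^sub>1 \<Gamma>\<^sub>2 (\<sigma> k) (tl (xs k)) Z (X (Suc k))"
      by (cases "xs k") auto
    note process = front_process_point[OF C1 params front Z(1)]
    obtain vD where vD: "weakly_covers F Z {refined_point F \<alpha>\<^sub>0 \<delta> \<gamma> \<Gamma>\<^sub>1 \<Gamma>\<^sub>2 (\<sigma> k) ?x vD}"
      using process(3) hd by blast
    define z where "z = refined_point F \<alpha>\<^sub>0 \<delta> \<gamma> \<Gamma>\<^sub>1 \<Gamma>\<^sub>2 (\<sigma> k) ?x vD"
    have "weakly_covers F (X (Suc k)) Z"
      using front_process_points[OF C1 params process(1) Z(2)] by blast
    moreover have "weakly_covers F (X l) (X (Suc k))"
      using covers \<open>k < l\<close> by simp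
    ultimately have "weakly_covers F (X l) {z}"
      using vD weakly_covers_trans unfolding z_def by metis
    then obtain j where "F (hd (xs l)) $ j \<le> F z $ j"
      using mutually_nondominated_le_component front hd unfolding front_def by blast
    moreover have "F z $ j \<le> F ?x $ j - \<beta>"
      unfolding z_def using \<beta>(2) X_subset hd that(1) unfolding N_def by force
    \<comment> \<open>A gap of \<beta> in one component is a gap of at least \<beta> in
      norm.\<close>
    moreover have "dist (F (hd (xs l)) $ j) (F ?x $ j) \<le> dist (F (hd (xs l))) (F ?x)"
      by (rule dist_vec_nth_le)
    ultimately show ?thesis
      by (simp add: dist_real_def)
  qed
  assume "infinite {k. theta F (hd (xs k)) < - \<epsilon> \<and> \<sigma> k \<le> \<epsilon>}"
  then have "infinite N"
    by (simp add: N_def)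
  have "compact (F ` L)"
    using \<open>compact L\<close> continuous_on_differentiable[OF C1] by (intro compact_continuous_image)
  moreover have "F (hd (xs (enumerate N n))) \<in> F ` L" for n
    using X_subset hd by blast
  ultimately obtain m n where "m < n"
    "dist (F (hd (xs (enumerate N n)))) (F (hd (xs (enumerate N m)))) < \<beta>"
    using compact_no_separated_sequence[of "F ` L" "\<lambda>n. F (hd (xs (enumerate N n)))"] \<beta>(1) by blast
  then show False
    using separated[of "enumerate N m" "enumerate N n"] \<open>infinite N\<close>
    by (auto simp: enumerate_in_set enumerate_mono)
qed

theorem theorem5p15:
  fixes F :: "real^'n \<Rightarrow> real^'m"
    and \<alpha>\<^sub>0 \<delta> \<gamma> \<Gamma>\<^sub>1 \<Gamma>\<^sub>2 :: real
    and \<sigma> :: "nat \<Rightarrow> real"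
    and xs :: "nat \<Rightarrow> (real^'n) list"
    and X :: "nat \<Rightarrow> (real^'n) set"
    and x\<^sub>0 :: "real^'n"
  assumes C1: "continuously_differentiable F"
    and params: "\<alpha>\<^sub>0 > 0" "0 < \<delta>" "\<delta> < 1" "0 < \<gamma>" "\<gamma> < 1" "\<Gamma>\<^sub>1 > 0" "\<Gamma>\<^sub>2 > 0"
    and sigma_nonneg: "\<And>k. \<sigma> k \<ge> 0"
    and init: "finite (X 0)" "mutually_nondominated F (X 0)"
    and x0: "x\<^sub>0 \<in> X 0" "compact (\<Union>j. {x. F x $ j \<le> F x\<^sub>0 $ j})"
    and run: "front_descent_run F \<alpha>\<^sub>0 \<delta> \<gamma> \<Gamma>\<^sub>1 \<Gamma>\<^sub>2 \<sigma> xs X"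
    and first: "\<And>k. is_arg_min (theta F) (\<lambda>x. x \<in> X k) (hd (xs k))"
  shows "(\<forall>s>0. (\<forall>k. \<sigma> k = s) \<longrightarrow> (\<exists>kbar. \<forall>k\<ge>kbar. Theta F (X k) \<ge> - s)) \<and>
         (\<sigma> \<longlonglongrightarrow> 0 \<longrightarrow> (\<lambda>k. Theta F (X k)) \<longlonglongrightarrow> 0)"
proof -
  have hd: "hd (xs k) \<in> X k" for k
    using first[of k] by (simp add: is_arg_min_def)
  \<comment> \<open>The infimum is attained at the point processed first.\<close>
  have Theta: "Theta F (X k) = theta F (hd (xs k))" for k
    unfolding Theta_def using first[of k] by (intro cInf_eq_minimum) (auto simp: is_arg_min_linorder)
  have Theta_nonpos: "Theta F (X k) \<le> 0" for k
    by (simp add: Theta theta_on_eq)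
  have "front F (X 0)"
    using init by (simp add: front_def)
  note large = finite_large_refinements[OF C1 params(1-6) sigma_nonneg this x0 run hd, folded Theta]
  \<comment> \<open>Finiteness of the exceptional set of iterations, read as an eventual
    property.\<close>
  have *: "\<forall>\<^sub>F k in sequentially. \<sigma> k \<le> \<epsilon> \<longrightarrow> - \<epsilon> \<le> Theta F (X k)" if "\<epsilon> > 0" for \<epsilon>
    using large[OF that]
    by (simp add: cofinite_eq_sequentially[symmetric] eventually_cofinite not_le conj_commute)
  show ?thesis
  proof (intro conjI allI impI)
    fix s :: real assume "s > 0" "\<forall>k. \<sigma> k = s"
    then show "\<exists>kbar. \<forall>k\<ge>kbar. Theta F (X k) \<ge> - s"
      using *[of s] by (simp add: eventually_sequentially)
  next
    assume \<sigma>: "\<sigma> \<longlonglongrightarrow> 0"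
    show "(\<lambda>k. Theta F (X k)) \<longlonglongrightarrow> 0"
    proof (rule tendstoI)
      \<comment> \<open>Using e / 2 turns the weak bound on \<open>Theta\<close> into the strict one
        required; the upper side is \<open>Theta_nonpos\<close>.\<close>
      fix e :: real assume "e > 0"
      then have "\<forall>\<^sub>F k in sequentially. \<sigma> k < e / 2"
        using order_tendstoD(2)[OF \<sigma>, of "e / 2"] by simp
      moreover have "\<forall>\<^sub>F k in sequentially. \<sigma> k \<le> e / 2 \<longrightarrow> - (e / 2) \<le> Theta F (X k)"
        using \<open>e > 0\<close> by (intro *) simp
      ultimately show "\<forall>\<^sub>F k in sequentially. dist (Theta F (X k)) 0 < e"
      proof eventually_elim
        case (elim k)
        with Theta_nonpos[of k] \<open>e > 0\<close> show ?case
          by (simp add: dist_real_def)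
      qed
    qed
  qed
qed

end
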